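(* Let $J:\mathbb{R}^M\to\mathbb{R}$ be differentiable, $B\in\mathbb{R}^{E\times M}$, $b\in\mathbb{R}^E$, $\mu_w,\mu_\lambda>0$ and $\rho\ge 0$. For a scalar $c\geq 0$ put $J_c(w)=J(w)+\frac{c}{2}\|Bw-b\|^2$. Consider the incremental recursion, for $i\ge0$, $$w_i=w_{i-1}-\mu_w\big(\nabla J_\rho(w_{i-1})+B^{\mathsf T}\lambda_{i-1}\big),\qquad \lambda_i=\lambda_{i-1}+\mu_\lambda(Bw_i-b),$$ started at $(w_{-1},\lambda_{-1})\in\mathbb{R}^M\times\mathbb{R}^E$, and the non-incremental recursion, for $i\ge 0$, $$w'_i=w'_{i-1}-\mu_w\big(\nabla J_\eta(w'_{i-1})+B^{\mathsf T}\lambda'_{i-1}\big),\qquad \lambda'_i=\lambda'_{i-1}+\mu_\lambda(Bw'_{i-1}-b),$$ started at $(w'_{-1},\lambda'_{-1})$ with $w'_{-1}=w_{-1}$. If $\eta=\rho+\mu_\lambda$ and $\lambda'_{-1}=\lambda_{-1}-\mu_\lambda(Bw_{-1}-b)$, then the primal iterates of the two recursions coincide: $w'_i=w_i$ for all $i\ge -1$.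
   Context: Norms are Euclidean. The two recursions are primal-descent dual-ascent gradient methods for the problem $\min_w J(w)$ s.t. $Bw=b$; they use the same step-sizes $\mu_w,\mu_\lambda$ and differ in that the dual update uses the new primal iterate (incremental) or the previous primal iterate (non-incremental). *)

theory Defs
  imports "HOL-Analysis.Analysis"
begin

(* \<open>GDERIV f x :> g\<close> determines g uniquely when it holds; the value is unspecified
   where f is not differentiable. *)
definition gradient :: "('a::real_inner \<Rightarrow> real) \<Rightarrow> 'a \<Rightarrow> 'a" where
  "gradient f x = (THE g. GDERIV f x :> g)"

definition augmented_cost ::
  "(real ^ 'm \<Rightarrow> real) \<Rightarrow> real ^ 'm ^ 'e \<Rightarrow> real ^ 'e \<Rightarrow> real \<Rightarrow> real ^ 'm \<Rightarrow> real" where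
  "augmented_cost J B b c w = J w + c / 2 * (norm (B *v w - b))\<^sup>2"

(* Iterates are indexed by the integers, with the starting point at index -1; values at
   indices below -1 are unconstrained.  In both predicates c is the penalty parameter of
   the augmented cost. *)
definition incremental_recursion ::
  "(real ^ 'm \<Rightarrow> real) \<Rightarrow> real ^ 'm ^ 'e \<Rightarrow> real ^ 'e \<Rightarrow> real \<Rightarrow> real \<Rightarrow> real \<Rightarrow>
   (int \<Rightarrow> real ^ 'm) \<Rightarrow> (int \<Rightarrow> real ^ 'e) \<Rightarrow> bool" where
  "incremental_recursion J B b mu_w mu_lam c w lam \<longleftrightarrow>
     (\<forall>i\<ge>0. w i = w (i - 1)
               - mu_w *\<^sub>R (gradient (augmented_cost J B b c) (w (i - 1)) + transpose B *v lam (i - 1)) \<and>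
             lam i = lam (i - 1) + mu_lam *\<^sub>R (B *v w i - b))"

definition nonincremental_recursion ::
  "(real ^ 'm \<Rightarrow> real) \<Rightarrow> real ^ 'm ^ 'e \<Rightarrow> real ^ 'e \<Rightarrow> real \<Rightarrow> real \<Rightarrow> real \<Rightarrow>
   (int \<Rightarrow> real ^ 'm) \<Rightarrow> (int \<Rightarrow> real ^ 'e) \<Rightarrow> bool" where
  "nonincremental_recursion J B b mu_w mu_lam c w lam \<longleftrightarrow>
     (\<forall>i\<ge>0. w i = w (i - 1)
               - mu_w *\<^sub>R (gradient (augmented_cost J B b c) (w (i - 1)) + transpose B *v lam (i - 1)) \<and>
             lam i = lam (i - 1) + mu_lam *\<^sub>R (B *v w (i - 1) - b))"

end

theory Submission
  imports Defs
begin

(* The shifted multiplier lam i - mu_lam (B w i - b) of the incremental recursion obeys the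
   non-incremental dual update, and inserting it in the primal update amounts to raising the
   penalty from rho to rho + mu_lam, because the gradient of c/2 |B x - b|^2 is c B^T (B x - b). *)

text \<open>The derivative at a point is unique and a vector is determined by its inner products, so
  the definite description picks out any gradient that has been exhibited.\<close>

lemma gradient_eq:
  assumes "GDERIV f x :> g"
  shows "gradient f x = g"
  unfolding gradient_def
proof (rule the_equality)
  show "GDERIV f x :> g" by fact
next
  fix g' assume "GDERIV f x :> g'"
  then have "(\<lambda>h. h \<bullet> g') = (\<lambda>h. h \<bullet> g)"
    using assms has_derivative_unique unfolding gderiv_def by blast
  then have "h \<bullet> g' = h \<bullet> g" for h
    by meson
  then show "g' = g"
    by (rule vector_eq_ldot[THEN iffD1, OF allI])
qed

text \<open>Riesz representation in finite dimension: the derivative \<open>D\<close> is a linear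
  functional, and \<open>D h = D h * 1\<close> is the inner product of \<open>h\<close> with
  \<open>adjoint D 1\<close>.\<close>

lemma differentiable_imp_GDERIV_gradient:
  fixes f :: "'a::euclidean_space \<Rightarrow> real"
  assumes "f differentiable (at x)"
  shows "GDERIV f x :> gradient f x"
proof -
  obtain D where D: "(f has_derivative D) (at x)"
    using assms unfolding differentiable_def by blast
  have "D h = h \<bullet> adjoint D 1" for h
    using adjoint_works[OF has_derivative_linear[OF D], of h 1] by simp
  then have "D = (\<lambda>h. h \<bullet> adjoint D 1)" by blast
  then have "GDERIV f x :> adjoint D 1"
    using D unfolding gderiv_def by metis
  then show ?thesis
    using gradient_eq by metis
qed

lemma gradient_augmented_cost:
  fixes J :: "real ^ 'm \<Rightarrow> real" and B :: "real ^ 'm ^ 'e"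
  assumes "J differentiable (at x)"
  shows "gradient (augmented_cost J B b c) x
           = gradient J x + c *\<^sub>R (transpose B *v (B *v x - b))"
proof (rule gradient_eq)
  have J: "(J has_derivative (\<lambda>h. h \<bullet> gradient J x)) (at x)"
    using differentiable_imp_GDERIV_gradient[OF assms] unfolding gderiv_def .
  have B: "((\<lambda>w. B *v w) has_derivative (\<lambda>h. B *v h)) (at x)"
    by (rule bounded_linear_imp_has_derivative) (rule matrix_vector_mul_bounded_linear)
  have adj: "h \<bullet> (transpose B *v y) = (B *v h) \<bullet> y" for h y
    unfolding transpose_matrix_vector
    by (metis dot_lmul_matrix inner_commute)
  have r: "((\<lambda>w. B *v w - b) has_derivative (\<lambda>h. B *v h)) (at x)"
    using has_derivative_diff[OF B has_derivative_const[of b]] by simp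
  \<comment> \<open>With the squared norm written as an inner product, the product rule yields two
    terms that agree by symmetry; their sum absorbs the factor 1/2.\<close>
  have "((\<lambda>w. J w + c / 2 * ((B *v w - b) \<bullet> (B *v w - b))) has_derivative
      (\<lambda>h. h \<bullet> gradient J x
         + c / 2 * ((B *v x - b) \<bullet> (B *v h) + (B *v h) \<bullet> (B *v x - b)))) (at x)"
    by (intro has_derivative_add J has_derivative_mult_right has_derivative_inner r)
  moreover have "h \<bullet> gradient J x
         + c / 2 * ((B *v x - b) \<bullet> (B *v h) + (B *v h) \<bullet> (B *v x - b))
      = h \<bullet> (gradient J x + c *\<^sub>R (transpose B *v (B *v x - b)))" for h
  proof -
    have half: "p = q \<Longrightarrow> u + c / 2 * (p + q) = u + c * q" for p q u :: real
      by simp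
    show ?thesis
      unfolding inner_add_right inner_scaleR_right adj by (intro half inner_commute)
  qed
  ultimately show "GDERIV (augmented_cost J B b c) x :>
      gradient J x + c *\<^sub>R (transpose B *v (B *v x - b))"
    unfolding gderiv_def augmented_cost_def power2_norm_eq_inner by (simp only:)
qed

theorem lemma3:
  fixes J :: "real ^ 'm \<Rightarrow> real"
    and B :: "real ^ 'm ^ 'e"
    and b :: "real ^ 'e"
    and mu_w mu_lam rho eta :: real
    and w w' :: "int \<Rightarrow> real ^ 'm"
    and lam lam' :: "int \<Rightarrow> real ^ 'e"
  assumes "\<And>x. J differentiable (at x)"
    and "mu_w > 0" and "mu_lam > 0" and "rho \<ge> 0"
    and "incremental_recursion J B b mu_w mu_lam rho w lam"
    and "nonincremental_recursion J B b mu_w mu_lam eta w' lam'"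
    and "w' (-1) = w (-1)"
    and "eta = rho + mu_lam"
    and "lam' (-1) = lam (-1) - mu_lam *\<^sub>R (B *v w (-1) - b)"
  shows "\<forall>i\<ge>-1. w' i = w i"
proof -
  \<comment> \<open>The primal claim alone is not inductive, so the multiplier relation is carried
    along; at index -1 it is the hypothesis on the starting points.\<close>
  have "w' i = w i \<and> lam' i = lam i - mu_lam *\<^sub>R (B *v w i - b)" if "i \<ge> -1" for i
    using that
  proof (induction i rule: int_ge_induct)
    case base
    show ?case using assms(7,9) by simp
  next
    case (step i)
    have inc: "w (i + 1) = w i - mu_w *\<^sub>R (gradient (augmented_cost J B b rho) (w i) + transpose B *v lam i)"
      "lam (i + 1) = lam i + mu_lam *\<^sub>R (B *v w (i + 1) - b)"
      using assms(5)[unfolded incremental_recursion_def, rule_format, of "i + 1"] step.hyps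
      by auto
    have non: "w' (i + 1) = w' i - mu_w *\<^sub>R (gradient (augmented_cost J B b eta) (w' i) + transpose B *v lam' i)"
      "lam' (i + 1) = lam' i + mu_lam *\<^sub>R (B *v w' i - b)"
      using assms(6)[unfolded nonincremental_recursion_def, rule_format, of "i + 1"] step.hyps
      by auto
    \<comment> \<open>The extra penalty contributes
      \<open>mu_lam *\<^sub>R (transpose B *v (B *v w i - b))\<close>, which the shift of the
      multiplier cancels.\<close>
    have "gradient (augmented_cost J B b eta) (w i) + transpose B *v (lam i - mu_lam *\<^sub>R (B *v w i - b))
        = gradient (augmented_cost J B b rho) (w i) + transpose B *v lam i"
      unfolding gradient_augmented_cost[OF assms(1)] assms(8)
      by (simp add: matrix_vector_mult_diff_distrib matrix_vector_mult_scaleR algebra_simps)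
    \<comment> \<open>For the dual part, the update of \<open>lam'\<close> undoes the shift at
      \<open>i\<close>, so \<open>lam' (i + 1) = lam i\<close>; this is \<open>lam (i + 1)\<close>
      minus its last increment, hence the shift at \<open>i + 1\<close>.\<close>
    then show ?case
      using inc non step.IH by simp
  qed
  then show ?thesis by blast
qed

end
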